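(* Let $f:\mathbf E\to\overline{\mathbb R}$ and $g:\mathbf F\to\overline{\mathbb R}$ be proper, closed and convex, and let $A:\mathbf E\to\mathbf F$ be linear. Suppose that: 1. (Strict complementarity) there is an optimal primal-dual pair $z_{\star0}=(x_{\star0},y_{\star0})$ of $(\mathrm P_c)$ and $(\mathrm D_c)$ satisfying strict complementarity; 2. (Quadratic subdifferential violation) the subdifferentials $\partial f(x_{\star0})$, $\partial g(Ax_{\star0})$, $\partial f^*(-A^\top y_{\star0})$ and $\partial g^*(y_{\star0})$ satisfy quadratic subdifferential violation relative to $-A^\top y_{\star0}$, $y_{\star0}$, $x_{\star0}$ and $Ax_{\star0}$, respectively. Fix $\beta>0$. Then there is an $r>0$ such that for any compact set $\mathcal B\subset\mathbf E^2\times\mathbf F^2$ there are constants $\alpha_1,\alpha_2>0$ such that for all $(x,v,y,u)\in\mathcal B$ (with $x,v\in\mathbf E$, $y,u\in\mathbf F$) and all $z_\star=(x_\star,y_\star)\in\mathcal Z_\star\cap B_r(z_{\star0})$, $$L_\beta^P(x,u,y_\star)-L_\beta^P(x_\star,Ax_\star,y_\star)\ge\alpha_1\operatorname{dist}^2((x,u),\mathcal P_\star),$$ $$L_\beta^D(y,v,x_\star)-L_\beta^D(y_\star,-A^\top y_\star,x_\star)\ge\alpha_2\operatorname{dist}^2((y,v),\mathcal D_\star),$$ where $\mathcal P_\star=\{(x,Ax):x\in\mathcal X_\star\}$ and $\mathcal D_\star=\{(y,-A^\top y):y\in\mathcal Y_\star\}$.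
   Context: $\mathbf E,\mathbf F$ are finite-dimensional Euclidean spaces, $A^\top$ is the adjoint of $A$, $f^*,g^*$ are convex conjugates, $\overline{\mathbb R}=\mathbb R\cup\{+\infty\}$. $(\mathrm P_c)$: $\inf_{x\in\mathbf E}f(x)+g(Ax)$. $(\mathrm D_c)$: $\sup_{y\in\mathbf F}\{-f^*(-A^\top y)-g^*(y)\}$. $\mathcal X_\star$, $\mathcal Y_\star$ are their optimal solution sets and $\mathcal Z_\star=\mathcal X_\star\times\mathcal Y_\star$. $B_r(z)$ is the closed ball. Strict complementarity of an optimal primal-dual pair $(x_\star,y_\star)$: $(x_\star,Ax_\star)\in\operatorname{relint}(\partial f^*(-A^\top y_\star))\times\operatorname{relint}(\partial g^*(y_\star))$ and $(y_\star,-A^\top y_\star)\in\operatorname{relint}(\partial g(Ax_\star))\times\operatorname{relint}(\partial f(x_\star))$. Quadratic subdifferential violation (QSV): for a proper closed convex $h$ and $x$ with $\partial h(x)\ne\emptyset$, $\partial h(x)$ satisfies QSV relative to $v\in\partial h(x)$ if for every compact set $\mathcal X$ there is $\alpha>0$ with $h(y)\ge h(x)+\langle v,y-x\rangle+\frac\alpha2\operatorname{dist}^2(y,(\partial h)^{-1}(v))$ for all $y\in\mathcal X$, where $(\partial h)^{-1}(v)=\{w:v\in\partial h(w)\}$. Augmented Lagrangians: $L_\beta^P(x,u,y)=f(x)+g(u)+\langle y,Ax-u\rangle+\frac1{2\beta}\|Ax-u\|^2$, $L_\beta^D(y,v,x)=f^*(v)+g^*(y)+\langle x,-A^\top y-v\rangle+\frac1{2\beta}\|A^\top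 y+v\|^2$. *)

theory Defs
  imports "HOL-Analysis.Analysis"
begin

text \<open>Extended-real-valued convex functions have type \<open>'a \<Rightarrow> ereal\<close>; the codomain
  \<open>\<real> \<union> {+\<infinity>}\<close> is enforced by the first conjunct of \<open>proper_fun\<close>.\<close>

definition epi :: "('a::euclidean_space \<Rightarrow> ereal) \<Rightarrow> ('a \<times> real) set" where
  "epi h = {(x, t). h x \<le> ereal t}"

definition proper_fun :: "('a::euclidean_space \<Rightarrow> ereal) \<Rightarrow> bool" where
  "proper_fun h \<longleftrightarrow> (\<forall>x. h x \<noteq> -\<infinity>) \<and> (\<exists>x. h x \<noteq> \<infinity>)"

definition closed_fun :: "('a::euclidean_space \<Rightarrow> ereal) \<Rightarrow> bool" where
  "closed_fun h \<longleftrightarrow> closed (epi h)"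

definition convex_fun :: "('a::euclidean_space \<Rightarrow> ereal) \<Rightarrow> bool" where
  "convex_fun h \<longleftrightarrow> convex (epi h)"

definition conjugate :: "('a::euclidean_space \<Rightarrow> ereal) \<Rightarrow> 'a \<Rightarrow> ereal" where
  "conjugate h v = (SUP x. ereal (v \<bullet> x) - h x)"

text \<open>For proper \<open>h\<close> this set is empty whenever \<open>h x = \<infinity>\<close>.\<close>

definition subdiff :: "('a::euclidean_space \<Rightarrow> ereal) \<Rightarrow> 'a \<Rightarrow> 'a set" where
  "subdiff h x = {v. \<forall>y. h y \<ge> h x + ereal (v \<bullet> (y - x))}"

definition subdiff_inv :: "('a::euclidean_space \<Rightarrow> ereal) \<Rightarrow> 'a \<Rightarrow> 'a set" where
  "subdiff_inv h v = {w. v \<in> subdiff h w}"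

text \<open>\<open>infdist\<close> to the empty set is 0 by convention; here the set contains \<open>x\<close>.\<close>

definition QSV :: "('a::euclidean_space \<Rightarrow> ereal) \<Rightarrow> 'a \<Rightarrow> 'a \<Rightarrow> bool" where
  "QSV h x v \<longleftrightarrow> v \<in> subdiff h x \<and>
     (\<forall>K. compact K \<longrightarrow>
        (\<exists>\<alpha>>0. \<forall>y\<in>K.
           h y \<ge> h x + ereal (v \<bullet> (y - x))
                 + ereal (\<alpha> / 2 * (infdist y (subdiff_inv h v))\<^sup>2)))"

definition primal_obj ::
  "('e::euclidean_space \<Rightarrow> ereal) \<Rightarrow> ('f::euclidean_space \<Rightarrow> ereal) \<Rightarrow> ('e \<Rightarrow> 'f) \<Rightarrow> 'e \<Rightarrow> ereal"
  where "primal_obj f g A x = f x + g (A x)"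

definition dual_obj ::
  "('e::euclidean_space \<Rightarrow> ereal) \<Rightarrow> ('f::euclidean_space \<Rightarrow> ereal) \<Rightarrow> ('e \<Rightarrow> 'f) \<Rightarrow> 'f \<Rightarrow> ereal"
  where "dual_obj f g A y = - conjugate f (- adjoint A y) - conjugate g y"

text \<open>Optimal solutions are feasible: an infeasible problem has none.\<close>

definition primal_opt ::
  "('e::euclidean_space \<Rightarrow> ereal) \<Rightarrow> ('f::euclidean_space \<Rightarrow> ereal) \<Rightarrow> ('e \<Rightarrow> 'f) \<Rightarrow> 'e set"
  where "primal_opt f g A =
    {x. primal_obj f g A x \<noteq> \<infinity> \<and> primal_obj f g A x = (INF x'. primal_obj f g A x')}"

definition dual_opt ::
  "('e::euclidean_space \<Rightarrow> ereal) \<Rightarrow> ('f::euclidean_space \<Rightarrow> ereal) \<Rightarrow> ('e \<Rightarrow> 'f) \<Rightarrow> 'f set"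
  where "dual_opt f g A =
    {y. dual_obj f g A y \<noteq> -\<infinity> \<and> dual_obj f g A y = (SUP y'. dual_obj f g A y')}"

definition primal_dual_opt ::
  "('e::euclidean_space \<Rightarrow> ereal) \<Rightarrow> ('f::euclidean_space \<Rightarrow> ereal) \<Rightarrow> ('e \<Rightarrow> 'f) \<Rightarrow> ('e \<times> 'f) set"
  where "primal_dual_opt f g A = primal_opt f g A \<times> dual_opt f g A"

definition strict_compl ::
  "('e::euclidean_space \<Rightarrow> ereal) \<Rightarrow> ('f::euclidean_space \<Rightarrow> ereal) \<Rightarrow> ('e \<Rightarrow> 'f) \<Rightarrow> 'e \<Rightarrow> 'f \<Rightarrow> bool"
  where "strict_compl f g A x y \<longleftrightarrow>
    (x, A x) \<in> rel_interior (subdiff (conjugate f) (- adjoint A y))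
               \<times> rel_interior (subdiff (conjugate g) y) \<and>
    (y, - adjoint A y) \<in> rel_interior (subdiff g (A x)) \<times> rel_interior (subdiff f x)"

definition aug_lag_P ::
  "real \<Rightarrow> ('e::euclidean_space \<Rightarrow> ereal) \<Rightarrow> ('f::euclidean_space \<Rightarrow> ereal) \<Rightarrow> ('e \<Rightarrow> 'f)
    \<Rightarrow> 'e \<Rightarrow> 'f \<Rightarrow> 'f \<Rightarrow> ereal"
  where "aug_lag_P \<beta> f g A x u y =
    f x + g u + ereal (y \<bullet> (A x - u)) + ereal (1 / (2 * \<beta>) * (norm (A x - u))\<^sup>2)"

definition aug_lag_D ::
  "real \<Rightarrow> ('e::euclidean_space \<Rightarrow> ereal) \<Rightarrow> ('f::euclidean_space \<Rightarrow> ereal) \<Rightarrow> ('e \<Rightarrow> 'f)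
    \<Rightarrow> 'f \<Rightarrow> 'e \<Rightarrow> 'e \<Rightarrow> ereal"
  where "aug_lag_D \<beta> f g A y v x =
    conjugate f v + conjugate g y + ereal (x \<bullet> (- adjoint A y - v))
      + ereal (1 / (2 * \<beta>) * (norm (adjoint A y + v))\<^sup>2)"

definition P_star ::
  "('e::euclidean_space \<Rightarrow> ereal) \<Rightarrow> ('f::euclidean_space \<Rightarrow> ereal) \<Rightarrow> ('e \<Rightarrow> 'f) \<Rightarrow> ('e \<times> 'f) set"
  where "P_star f g A = {(x, A x) | x. x \<in> primal_opt f g A}"

definition D_star ::
  "('e::euclidean_space \<Rightarrow> ereal) \<Rightarrow> ('f::euclidean_space \<Rightarrow> ereal) \<Rightarrow> ('e \<Rightarrow> 'f) \<Rightarrow> ('f \<times> 'e) set"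
  where "D_star f g A = {(y, - adjoint A y) | y. y \<in> dual_opt f g A}"

end

theory Submission imports Defs begin

text \<open>Since \<open>(x0, y0)\<close> certifies strong duality, the primal solutions are the \<open>x\<close> with
  \<open>(x, A x)\<close> in the product of \<open>\<partial>f*(- A\<^sup>T y0)\<close> and \<open>\<partial>g*(y0)\<close>. Quadratic subdifferential violation
  bounds the Lagrangian gap below by the squared distances to these two sets plus the squared
  residual \<open>A x - u\<close>, uniformly for multipliers near \<open>y0\<close> because \<open>y0\<close> is relatively interior. As
  \<open>(x0, A x0)\<close> is relatively interior to the product, the product and the graph of \<open>A\<close> are
  boundedly linearly regular, which turns this into the squared distance to the solution set. The
  dual bound is the same statement for \<open>(g*, f*, - A\<^sup>T)\<close>.\<close>

section \<open>Subgradients, conjugates and their inversion\<close>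

lemma subdiff_finite:
  assumes "proper_fun h" "v \<in> subdiff h x"
  shows "\<bar>h x\<bar> \<noteq> \<infinity>"
proof -
  obtain y where y: "h y \<noteq> \<infinity>" using assms(1) unfolding proper_fun_def by blast
  have "h x + ereal (v \<bullet> (y - x)) \<le> h y" using assms(2) unfolding subdiff_def by auto
  then have "h x \<noteq> \<infinity>" using y by auto
  then show ?thesis using assms(1) unfolding proper_fun_def by auto
qed

lemma conjugate_ge: "ereal (v \<bullet> x) - h x \<le> conjugate h v"
  unfolding conjugate_def by (rule SUP_upper) simp

lemma conjugate_not_MInf:
  assumes "proper_fun h"
  shows "conjugate h v \<noteq> -\<infinity>"
proof -
  obtain y where y: "h y \<noteq> \<infinity>" using assms unfolding proper_fun_def by blast
  then obtain r where r: "h y = ereal r" using assms unfolding proper_fun_def by (cases "h y") auto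
  show ?thesis using conjugate_ge[of v y h] r by auto
qed

lemma conjugate_eq_subdiff:
  assumes "proper_fun h" "v \<in> subdiff h x"
  shows "conjugate h v = ereal (v \<bullet> x) - h x"
proof (rule antisym)
  obtain r where r: "h x = ereal r" using subdiff_finite[OF assms] by auto
  show "conjugate h v \<le> ereal (v \<bullet> x) - h x"
    unfolding conjugate_def
  proof (rule SUP_least)
    fix y
    have "h x + ereal (v \<bullet> (y - x)) \<le> h y" using assms(2) unfolding subdiff_def by auto
    then show "ereal (v \<bullet> y) - h y \<le> ereal (v \<bullet> x) - h x"
      using r by (cases "h y") (auto simp: inner_diff_right)
  qed
qed (rule conjugate_ge)

lemma proper_fun_conjugate:
  assumes "proper_fun h" "v \<in> subdiff h x"
  shows "proper_fun (conjugate h)"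
proof -
  have "conjugate h v \<noteq> \<infinity>"
    using conjugate_eq_subdiff[OF assms] subdiff_finite[OF assms] by (cases "h x") auto
  then show ?thesis
    unfolding proper_fun_def using conjugate_not_MInf[OF assms(1)] by blast
qed

lemma conjugate_le_iff: "conjugate h w \<le> c \<longleftrightarrow> (\<forall>y. ereal (w \<bullet> y) - h y \<le> c)"
  unfolding conjugate_def by (simp add: SUP_le_iff)

text \<open>From right to left this is the equality case of the Fenchel-Young inequality. From left
  to right it carries the content of Fenchel-Moreau at the single point \<open>x\<close>: a strictly
  separating hyperplane of the closed convex epigraph is turned into a value of the conjugate that
  violates the subgradient inequality at \<open>v\<close>.\<close>

lemma subdiff_conjugate_iff:
  assumes h: "proper_fun h" "closed_fun h" "convex_fun h" and p: "proper_fun (conjugate h)"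
  shows "x \<in> subdiff (conjugate h) v \<longleftrightarrow> v \<in> subdiff h x"
proof
  assume v: "v \<in> subdiff h x"
  obtain r where r: "h x = ereal r" using subdiff_finite[OF h(1) v] by auto
  show "x \<in> subdiff (conjugate h) v"
    unfolding subdiff_def
  proof (intro CollectI allI)
    fix w
    have "ereal (w \<bullet> x) - h x \<le> conjugate h w" by (rule conjugate_ge)
    then show "conjugate h v + ereal (x \<bullet> (w - v)) \<le> conjugate h w"
      using r conjugate_eq_subdiff[OF h(1) v]
      by (simp add: inner_diff_right inner_commute)
  qed
next
  assume x: "x \<in> subdiff (conjugate h) v"
  obtain m where m: "conjugate h v = ereal m" using subdiff_finite[OF p x] by auto
  have sub: "ereal m + ereal (x \<bullet> (w - v)) \<le> conjugate h w" for w
    using x m unfolding subdiff_def by auto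
  \<comment> \<open>The value that equality in Fenchel-Young would give to \<open>h x\<close>. Since
    \<open>h y \<ge> v \<bullet> y - m\<close> for every \<open>y\<close>, the bound
    \<open>h x \<le> c\<close> is all that is needed for \<open>v\<close> to be a subgradient at
    \<open>x\<close>.\<close>
  define c where "c = v \<bullet> x - m"
  have "h x \<le> ereal c"
  proof (rule ccontr)
    assume "\<not> h x \<le> ereal c"
    then have "(x, c) \<notin> epi h" unfolding epi_def by auto
    then obtain q b where q: "q \<bullet> (x, c) < b" "\<And>z. z \<in> epi h \<Longrightarrow> b < q \<bullet> z"
      using separating_hyperplane_closed_point[of "epi h" "(x,c)"] h(2,3)
      unfolding closed_fun_def convex_fun_def by blast
    obtain a s where as: "q = (a, s)" by (cases q)
    have xc: "a \<bullet> x + s * c < b" using q(1) as by simp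
    have ep: "b < a \<bullet> y + s * t" if "h y \<le> ereal t" for y t
      using q(2)[of "(y,t)"] that as unfolding epi_def by simp
    obtain y0 r0 where y0: "h y0 = ereal r0"
      using h(1) unfolding proper_fun_def by (metis ereal_cases)
    have s0: "s \<ge> 0"
    proof (rule ccontr)
      assume neg: "\<not> s \<ge> 0"
      \<comment> \<open>The epigraph is unbounded upwards, so a negative \<open>s\<close> would push
        the linear form down to \<open>b\<close>; this height is large enough for that.\<close>
      define t where "t = max r0 ((b - a \<bullet> y0) / s)"
      have "b < a \<bullet> y0 + s * t" by (rule ep) (simp add: y0 t_def)
      moreover have "s * t \<le> s * ((b - a \<bullet> y0) / s)"
        using neg by (intro mult_left_mono_neg) (auto simp: t_def)
      ultimately show False using neg by simp
    qed
    show False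
    proof (cases "s = 0")
      case True
      \<comment> \<open>Vertical hyperplane: \<open>a \<bullet> y > b\<close> on the whole domain of
        \<open>h\<close>, so tilting \<open>v\<close> by \<open>- a\<close> lowers the conjugate by
        at least \<open>b\<close>. The subgradient \<open>x\<close> allows a drop of only
        \<open>a \<bullet> x\<close>, which is less than \<open>b\<close>.\<close>
      have "conjugate h (v - a) \<le> ereal (m - b)"
        unfolding conjugate_le_iff
      proof
        fix y
        have "ereal (v \<bullet> y) - h y \<le> ereal m" using conjugate_ge[of v y h] m by simp
        then show "ereal ((v - a) \<bullet> y) - h y \<le> ereal (m - b)"
          using ep[of y "real_of_ereal (h y)"] True
          by (cases "h y") (auto simp: inner_diff_left)
      qed
      with sub[of "v - a"] have "ereal m + ereal (x \<bullet> (v - a - v)) \<le> ereal (m - b)" by (rule order_trans)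
      then show False using xc True by (simp add: inner_commute)
    next
      case False
      with s0 have s: "s > 0" by simp
      \<comment> \<open>Solved for the height, the hyperplane is the graph of an affine minorant of
        \<open>h\<close> with slope \<open>- (1/s) *\<^sub>R a\<close>. The subgradient inequality
        at this slope, multiplied by \<open>s\<close>, puts \<open>(x, c)\<close> on the wrong
        side.\<close>
      have "conjugate h (- (1/s) *\<^sub>R a) \<le> ereal (- b / s)"
        unfolding conjugate_le_iff
      proof
        fix y
        show "ereal ((- (1/s) *\<^sub>R a) \<bullet> y) - h y \<le> ereal (- b / s)"
        proof (cases "h y")
          case (real t)
          then have "b / s < (a \<bullet> y + s * t) / s" using ep[of y t] s by (simp add: divide_strict_right_mono)
          then show ?thesis using real s by (simp add: add_divide_distrib)
        next
          case PInf
          then show ?thesis by simp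
        next
          case MInf
          then show ?thesis using h(1) unfolding proper_fun_def by simp
        qed
      qed
      with sub[of "- (1/s) *\<^sub>R a"]
      have "m + x \<bullet> (- (1/s) *\<^sub>R a - v) \<le> - b / s"
        by (metis order_trans ereal_less_eq(3) plus_ereal.simps(1))
      then have "m - (x \<bullet> a) / s - x \<bullet> v \<le> - b / s" by (simp add: inner_diff_right)
      then have "s * (m - (x \<bullet> a) / s - x \<bullet> v) \<le> s * (- b / s)" using s by (intro mult_left_mono) auto
      then have "s * m - x \<bullet> a - s * (x \<bullet> v) \<le> - b" using s by (simp add: right_diff_distrib)
      then show False using xc unfolding c_def by (simp add: inner_commute algebra_simps)
    qed
  qed
  moreover have "h x \<noteq> -\<infinity>" using h(1) unfolding proper_fun_def by simp
  ultimately obtain r where r: "h x = ereal r" "r \<le> c" by (cases "h x") auto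
  show "v \<in> subdiff h x"
    unfolding subdiff_def
  proof (intro CollectI allI)
    fix y
    have "ereal (v \<bullet> y) - h y \<le> ereal m" using conjugate_ge[of v y h] m by simp
    then show "h x + ereal (v \<bullet> (y - x)) \<le> h y"
      using r unfolding c_def by (cases "h y") (auto simp: inner_diff_right)
  qed
qed

lemma convex_subdiff:
  assumes "\<bar>h x\<bar> \<noteq> \<infinity>"
  shows "convex (subdiff h x)"
proof (rule convexI)
  obtain r where r: "h x = ereal r" using assms by auto
  fix v w :: 'a and s t :: real
  assume vw: "v \<in> subdiff h x" "w \<in> subdiff h x" and st: "0 \<le> s" "0 \<le> t" "s + t = 1"
  show "s *\<^sub>R v + t *\<^sub>R w \<in> subdiff h x"
    unfolding subdiff_def
  proof (intro CollectI allI)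
    fix y
    have 1: "ereal r + ereal (v \<bullet> (y - x)) \<le> h y" "ereal r + ereal (w \<bullet> (y - x)) \<le> h y"
      using vw r unfolding subdiff_def by auto
    show "h x + ereal ((s *\<^sub>R v + t *\<^sub>R w) \<bullet> (y - x)) \<le> h y"
    proof (cases "h y")
      case (real k)
      then have "s * (r + v \<bullet> (y - x)) + t * (r + w \<bullet> (y - x)) \<le> s * k + t * k"
        using 1 st by (intro add_mono mult_left_mono) auto
      also have "s * k + t * k = (s + t) * k" by (simp add: algebra_simps)
      also have "s * (r + v \<bullet> (y - x)) + t * (r + w \<bullet> (y - x))
          = (s + t) * r + (s * (v \<bullet> (y - x)) + t * (w \<bullet> (y - x)))"
        by (simp only: distrib_left distrib_right add_ac)
      finally show ?thesis using real r st by (simp add: inner_add_left)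
    qed (use 1 in auto)
  qed
qed

section \<open>Relatively interior subgradients and uniform growth\<close>

text \<open>The reflected point stays in the affine hull and lies twice as far from \<open>a\<close>
  as \<open>v\<close> does, so half the radius of a ball around \<open>a\<close> inside the hull
  suffices.\<close>

lemma rel_interior_reflect:
  fixes S :: "'a::euclidean_space set"
  assumes "a \<in> rel_interior S"
  shows "\<exists>e>0. \<forall>v\<in>S. dist a v \<le> e \<longrightarrow> 2 *\<^sub>R v - a \<in> S"
proof -
  obtain e where e: "e > 0" "cball a e \<inter> affine hull S \<subseteq> S" and a: "a \<in> S"
    using assms unfolding mem_rel_interior_cball by blast
  have "2 *\<^sub>R v - a \<in> S" if "v \<in> S" "dist a v \<le> e/2" for v
  proof -
    have "v + 1 *\<^sub>R (v - a) \<in> affine hull S"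
      using that a by (intro mem_affine_3_minus) (auto simp: hull_inc)
    then have "2 *\<^sub>R v - a \<in> affine hull S" by (simp add: scaleR_2 algebra_simps)
    moreover have "a - (2 *\<^sub>R v - a) = 2 *\<^sub>R (a - v)" by (simp add: scaleR_2 algebra_simps)
    then have "dist a (2 *\<^sub>R v - a) \<le> e" using that unfolding dist_norm by simp
    ultimately show ?thesis using e by auto
  qed
  then show ?thesis using e(1) by (intro exI[of _ "e/2"]) auto
qed

text \<open>If \<open>v\<close> is close to a relatively interior subgradient \<open>v0\<close>, its reflection \<open>2 v - v0\<close> is still
  a subgradient; averaging its subgradient inequality with the growth at \<open>v0\<close> gives growth at \<open>v\<close>
  with half the constant, uniformly in \<open>v\<close>.\<close>

lemma QSV_uniform:
  assumes fin: "\<bar>h x\<bar> \<noteq> \<infinity>" and q: "QSV h x v0" and ri: "v0 \<in> rel_interior (subdiff h x)"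
  shows "\<exists>e>0. \<forall>K. compact K \<longrightarrow> (\<exists>\<alpha>>0. \<forall>y\<in>K. \<forall>v\<in>subdiff h x. dist v0 v \<le> e \<longrightarrow>
    h y \<ge> h x + ereal (v \<bullet> (y - x)) + ereal (\<alpha> * (infdist y (subdiff_inv h v0))\<^sup>2))"
proof -
  obtain r where r: "h x = ereal r" using fin by auto
  obtain e where e: "e > 0" and re: "\<And>v. v \<in> subdiff h x \<Longrightarrow> dist v0 v \<le> e \<Longrightarrow> 2 *\<^sub>R v - v0 \<in> subdiff h x"
    using rel_interior_reflect[OF ri] by blast
  have "\<exists>\<alpha>>0. \<forall>y\<in>K. \<forall>v\<in>subdiff h x. dist v0 v \<le> e \<longrightarrow>
    h y \<ge> h x + ereal (v \<bullet> (y - x)) + ereal (\<alpha> * (infdist y (subdiff_inv h v0))\<^sup>2)"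
    if K: "compact K" for K
  proof -
    obtain \<alpha> where \<alpha>: "\<alpha> > 0" and gr: "\<And>y. y \<in> K \<Longrightarrow> h y \<ge> h x + ereal (v0 \<bullet> (y - x))
        + ereal (\<alpha> / 2 * (infdist y (subdiff_inv h v0))\<^sup>2)"
      using conjunct2[OF q[unfolded QSV_def], rule_format, OF K] by auto
    show ?thesis
    proof (intro exI[of _ "\<alpha> / 4"] conjI ballI impI)
      fix y v assume y: "y \<in> K" and v: "v \<in> subdiff h x" "dist v0 v \<le> e"
      define d where "d = (infdist y (subdiff_inv h v0))\<^sup>2"
      have 1: "h y \<ge> ereal (r + (2 * (v \<bullet> (y - x)) - v0 \<bullet> (y - x)))"
        using re[OF v] r unfolding subdiff_def by (simp add: inner_diff_left)
      have 2: "h y \<ge> ereal (r + v0 \<bullet> (y - x) + \<alpha> / 2 * d)"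
        using gr[OF y] unfolding r d_def by simp
      \<comment> \<open>Half the sum of the two bounds: the \<open>v0\<close> terms cancel, and
        \<open>\<alpha> / 2\<close> becomes \<open>\<alpha> / 4\<close>.\<close>
      have "h y \<ge> ereal (r + v \<bullet> (y - x) + \<alpha> / 4 * d)"
        using 1 2 by (cases "h y") auto
      then show "h y \<ge> h x + ereal (v \<bullet> (y - x)) + ereal (\<alpha> / 4 * (infdist y (subdiff_inv h v0))\<^sup>2)"
        unfolding r d_def by simp
    qed (use \<alpha> in auto)
  qed
  then show ?thesis using e by (intro exI[of _ e]) simp
qed

section \<open>Bounded linear regularity of a convex set and a kernel\<close>

text \<open>\<open>T\<close> is injective on the orthogonal complement \<open>W\<close> of its
  kernel within \<open>U\<close>, hence bounded below there by finite dimension. The point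
  \<open>p\<close> is the orthogonal projection of \<open>u\<close> onto that kernel.\<close>

lemma near_kernel:
  fixes T :: "'a::euclidean_space \<Rightarrow> 'b::euclidean_space"
  assumes U: "subspace U" and T: "linear T"
  shows "\<exists>\<kappa>>0. \<forall>u\<in>U. \<exists>p\<in>U. T p = 0 \<and> norm (u - p) \<le> \<kappa> * norm (T u)"
proof -
  interpret T: linear T by (rule T)
  define N where "N = U \<inter> {x. T x = 0}"
  have N: "subspace N" unfolding N_def using U T linear_subspace_kernel by (auto intro: subspace_inter)
  define W where "W = U \<inter> {y. \<forall>x\<in>N. orthogonal x y}"
  have W: "subspace W" unfolding W_def by (intro subspace_inter U subspace_orthogonal_to_vectors)
  \<comment> \<open>Such an \<open>x\<close> lies in \<open>N\<close> as well and is therefore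
    orthogonal to itself.\<close>
  have "\<forall>x\<in>W. T x = 0 \<longrightarrow> x = 0" unfolding W_def N_def by (force simp: orthogonal_def)
  then obtain e where e: "e > 0" "\<forall>x\<in>W. norm (T x) \<ge> e * norm x"
    using injective_imp_isometric[OF closed_subspace[OF W] W] T linear_conv_bounded_linear by blast
  show ?thesis
  proof (intro exI[of _ "1/e"] conjI ballI)
    fix u assume u: "u \<in> U"
    obtain p w where pw: "p \<in> span N" "\<And>x. x \<in> span N \<Longrightarrow> orthogonal w x" "u = p + w"
      using orthogonal_subspace_decomp_exists[of N u] by metis
    have pN: "p \<in> N" using pw(1) N by (simp add: span_eq_iff[THEN iffD2])
    have "w = u - p" using pw(3) by simp
    then have "w \<in> U" using u pN U unfolding N_def by (auto intro: subspace_diff)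
    then have wW: "w \<in> W" unfolding W_def using pw(2) by (auto simp: orthogonal_commute span_base)
    have "T u = T w" using pw(3) pN unfolding N_def by (simp add: T.add)
    then have "norm (u - p) \<le> 1 / e * norm (T u)"
      using e wW pw(3) by (simp add: field_simps)
    then show "\<exists>p\<in>U. T p = 0 \<and> norm (u - p) \<le> 1 / e * norm (T u)"
      using pN unfolding N_def by blast
  qed (use e in auto)
qed

text \<open>A point \<open>k\<close> of \<open>K\<close> is moved along the affine hull into the kernel, landing at \<open>p\<close>, and then
  towards \<open>z0\<close> until it re-enters \<open>K\<close>.\<close>

lemma bounded_linear_regularity:
  fixes T :: "'a::euclidean_space \<Rightarrow> 'b::euclidean_space"
  assumes K: "convex K" and z0: "z0 \<in> rel_interior K" and T: "linear T" "T z0 = 0" and R: "R \<ge> 0"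
  shows "\<exists>\<kappa>>0. \<forall>z k. dist z z0 \<le> R \<longrightarrow> k \<in> K \<longrightarrow>
    infdist z (K \<inter> {x. T x = 0}) \<le> \<kappa> * (dist z k + norm (T z))"
proof -
  interpret T: linear T by (rule T(1))
  obtain \<rho> where \<rho>: "\<rho> > 0" "cball z0 \<rho> \<inter> affine hull K \<subseteq> K" and z0K: "z0 \<in> K"
    using z0 unfolding mem_rel_interior_cball by blast
  define U where "U = (\<lambda>x. x - z0) ` (affine hull K)"
  have U: "subspace U" unfolding U_def
    using affine_diffs_subspace_subtract[of "affine hull K" z0] z0K by (simp add: hull_inc)
  obtain \<kappa>0 where k0: "\<kappa>0 > 0" and
    nk: "\<And>u. u \<in> U \<Longrightarrow> \<exists>p\<in>U. T p = 0 \<and> norm (u - p) \<le> \<kappa>0 * norm (T u)"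
    using near_kernel[OF U T(1)] by blast
  obtain b where b: "b > 0" "\<And>x. norm (T x) \<le> b * norm x"
    using linear_bounded_pos[OF T(1)] by blast
  \<comment> \<open>Bounds the distance from \<open>p\<close> to \<open>z0\<close>: the first term
    is for \<open>k\<close>, the second for the move from \<open>k\<close> to
    \<open>p\<close>.\<close>
  define M where "M = 2 * R + \<kappa>0 * (b * (2 * R))"
  have M: "M \<ge> 0" using R b k0 by (simp add: M_def)
  \<comment> \<open>The move from \<open>k\<close> to \<open>p\<close> costs \<open>d\<close>, the
    retreat from \<open>p\<close> to \<open>q\<close> at most \<open>d * (M / \<rho>)\<close>, and
    \<open>d\<close> is at most \<open>\<kappa>0 * (1 + b)\<close> times the error; the leading 1
    pays for \<open>dist z k\<close>.\<close>
  define \<kappa> where "\<kappa> = 1 + (1 + M / \<rho>) * \<kappa>0 * (1 + b)"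
  have k1: "\<kappa> \<ge> 1" unfolding \<kappa>_def using M \<rho> k0 b by simp
  let ?S = "K \<inter> {x. T x = 0}"
  have "infdist z ?S \<le> \<kappa> * (dist z k + norm (T z))" if z: "dist z z0 \<le> R" and k: "k \<in> K" for z k
  proof (cases "dist z z0 \<le> dist z k")
    case True
    \<comment> \<open>When \<open>k\<close> is no closer to \<open>z\<close> than \<open>z0\<close>
      is, \<open>z0\<close> itself is a good enough point of the intersection. In the other case
      \<open>k\<close> lies within \<open>2 * R\<close> of \<open>z0\<close>.\<close>
    have "infdist z ?S \<le> dist z z0" using z0K T(2) by (intro infdist_le) auto
    also have "\<dots> \<le> 1 * (dist z k + norm (T z))" using True by (simp add: add_increasing2)
    also have "\<dots> \<le> \<kappa> * (dist z k + norm (T z))" using k1 by (intro mult_right_mono) auto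
    finally show ?thesis .
  next
    case False
    have kz0: "norm (k - z0) \<le> 2 * R"
      using dist_triangle[of k z0 z] False z by (simp add: dist_commute dist_norm)
    have "k - z0 \<in> U" unfolding U_def using k by (simp add: hull_inc)
    then obtain p' where p': "p' \<in> U" "T p' = 0" "norm (k - z0 - p') \<le> \<kappa>0 * norm (T (k - z0))"
      using nk by blast
    define p where "p = z0 + p'"
    have pA: "p \<in> affine hull K" using p'(1) unfolding U_def p_def by auto
    have Tp: "T p = 0" using p' T unfolding p_def by (simp add: T.add)
    define d where "d = dist p k"
    have Tk: "T (k - z0) = T k" using T by (simp add: T.diff)
    have d1: "d \<le> \<kappa>0 * norm (T k)"
      using p'(3) unfolding d_def p_def dist_norm Tk by (metis norm_minus_commute diff_diff_eq)
    have "norm (T k) \<le> b * (2 * R)" using b(2)[of "k - z0"] kz0 b(1) Tk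
      by (smt (verit) mult_left_mono)
    then have "d \<le> \<kappa>0 * (b * (2 * R))" using d1 k0 by (smt (verit) mult_left_mono)
    then have pM: "dist p z0 \<le> M"
      using dist_triangle[of p z0 k] kz0 unfolding d_def M_def by (simp add: dist_norm)
    have "norm (T k) \<le> norm (T z) + b * dist z k"
    proof -
      have "T k = T z - T (z - k)" by (simp add: T.diff)
      then have "norm (T k) \<le> norm (T z) + norm (T (z - k))" by (metis norm_triangle_ineq4)
      then show ?thesis using b(2)[of "z - k"] by (simp add: dist_norm)
    qed
    also have "\<dots> \<le> (1 + b) * (dist z k + norm (T z))" using b(1) by (simp add: algebra_simps)
    finally have d2: "d \<le> \<kappa>0 * ((1 + b) * (dist z k + norm (T z)))"
      using d1 k0 by (smt (verit) mult_left_mono)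
    have d0: "d \<ge> 0" unfolding d_def by simp
    \<comment> \<open>Solves \<open>t * \<rho> = (1 - t) * d\<close>, which places the auxiliary
      point \<open>w\<close> below at distance exactly \<open>\<rho>\<close> from
      \<open>z0\<close>.\<close>
    define t where "t = d / (d + \<rho>)"
    have t: "0 \<le> t" "t \<le> 1" unfolding t_def using d0 \<rho>(1) by auto
    have td: "t \<le> d / \<rho>" unfolding t_def using d0 \<rho>(1) by (intro divide_left_mono) auto
    have t': "t * \<rho> = (1 - t) * d" unfolding t_def using d0 \<rho>(1) by (simp add: field_simps)
    define q where "q = (1 - t) *\<^sub>R p + t *\<^sub>R z0"
    have qK: "q \<in> K"
    proof (cases "d = 0")
      case True
      then show ?thesis using k unfolding q_def t_def d_def by simp
    next
      case False
      then have tp: "t > 0" unfolding t_def using d0 \<rho>(1) by simp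
      \<comment> \<open>Chosen so that \<open>q\<close>, a combination of \<open>p\<close> and
        \<open>z0\<close>, is also the combination of \<open>k\<close> and \<open>w\<close> with the
        same weights. Both \<open>k\<close> and \<open>w\<close> lie in \<open>K\<close>. The
        division by \<open>t\<close> is why \<open>d = 0\<close>, where \<open>q = k\<close>, is
        treated apart.\<close>
      define w where "w = z0 + ((1 - t) / t) *\<^sub>R (p - k)"
      have "w \<in> affine hull K" unfolding w_def
        by (rule mem_affine_3_minus) (use pA k z0K in \<open>auto simp: hull_inc\<close>)
      moreover have "dist z0 w \<le> \<rho>"
      proof -
        have "dist z0 w = (1 - t) / t * d"
          unfolding w_def dist_norm d_def using t tp by simp
        also have "\<dots> = \<rho>" using t' tp by (simp add: divide_eq_eq mult.commute)
        finally show ?thesis by simp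
      qed
      ultimately have wK: "w \<in> K" using \<rho>(2) by auto
      have "q = (1 - t) *\<^sub>R k + t *\<^sub>R w"
        unfolding q_def w_def using tp by (simp add: scaleR_add_right scaleR_diff_right)
      then show ?thesis using convexD_alt[OF K k wK, of t] t by simp
    qed
    have Tq: "T q = 0" unfolding q_def using Tp T(2) by (simp add: T.add T.scale)
    have "dist p q = t * dist p z0"
    proof -
      have "p - q = t *\<^sub>R (p - z0)" unfolding q_def by (simp add: algebra_simps)
      then show ?thesis using t by (simp add: dist_norm)
    qed
    also have "\<dots> \<le> d / \<rho> * M" using t td pM d0 \<rho>(1) by (intro mult_mono) auto
    finally have pq: "dist p q \<le> d * (M / \<rho>)" by simp
    have "infdist z ?S \<le> dist z q" using qK Tq by (intro infdist_le) auto
    also have "\<dots> \<le> dist z k + d + dist p q"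
      using dist_triangle[of z q k] dist_triangle[of k q p] unfolding d_def by (simp add: dist_commute)
    also have "\<dots> \<le> dist z k + (1 + M / \<rho>) * d" using pq by (simp add: algebra_simps)
    also have "\<dots> \<le> dist z k + (1 + M / \<rho>) * (\<kappa>0 * ((1 + b) * (dist z k + norm (T z))))"
      using d2 M \<rho>(1) by (intro add_left_mono mult_left_mono) auto
    also have "\<dots> \<le> (dist z k + norm (T z)) + (1 + M / \<rho>) * (\<kappa>0 * ((1 + b) * (dist z k + norm (T z))))"
      by simp
    also have "\<dots> = \<kappa> * (dist z k + norm (T z))" unfolding \<kappa>_def
      by (subst distrib_right) (simp only: mult_1 mult.assoc)
    finally show ?thesis .
  qed
  then show ?thesis using k1 by (intro exI[of _ \<kappa>]) auto
qed

lemma infdist_greatest: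
  assumes "S \<noteq> {}" "\<And>s. s \<in> S \<Longrightarrow> c \<le> dist x s"
  shows "c \<le> infdist x S"
  unfolding infdist_notempty[OF assms(1)] by (rule cINF_greatest) (use assms in auto)

text \<open>Bounded linear regularity for \<open>C \<times> D\<close> and the kernel of
  \<open>(x, u) \<mapsto> A x - u\<close>, which is the graph of \<open>A\<close>.\<close>

lemma graph_regularity:
  fixes A :: "'a::euclidean_space \<Rightarrow> 'b::euclidean_space"
  assumes C: "convex C" "x0 \<in> rel_interior C" and D: "convex D" "A x0 \<in> rel_interior D"
    and A: "linear A" and B: "bounded B"
  shows "\<exists>\<kappa>>0. \<forall>(x, u)\<in>B.
    infdist (x, u) {(x, A x) | x. x \<in> C \<and> A x \<in> D} \<le> \<kappa> * (infdist x C + infdist u D + norm (A x - u))"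
proof -
  interpret A: linear A by (rule A)
  define T where "T = (\<lambda>z. A (fst z) - snd z)"
  have T: "linear T" unfolding T_def
    by (rule linearI) (auto simp: A.add A.scale algebra_simps)
  have S: "{(x, A x) | x. x \<in> C \<and> A x \<in> D} = (C \<times> D) \<inter> {z. T z = 0}"
    unfolding T_def by auto
  have z0: "(x0, A x0) \<in> rel_interior (C \<times> D)"
    using rel_interior_Times[OF C(1) D(1)] C(2) D(2) by simp
  obtain R0 where R0: "\<And>z. z \<in> B \<Longrightarrow> dist (x0, A x0) z \<le> R0"
    using B unfolding bounded_any_center[where a="(x0, A x0)"] by blast
  \<comment> \<open>For empty \<open>B\<close> the bound \<open>R0\<close> may be negative.\<close>
  define R where "R = max R0 0"
  have RB: "dist z (x0, A x0) \<le> R" if "z \<in> B" for z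
    using R0[OF that] unfolding R_def by (simp add: dist_commute)
  obtain \<kappa> where k: "\<kappa> > 0" and reg: "\<And>z k. dist z (x0, A x0) \<le> R \<Longrightarrow> k \<in> C \<times> D \<Longrightarrow>
      infdist z ((C \<times> D) \<inter> {z. T z = 0}) \<le> \<kappa> * (dist z k + norm (T z))"
    using bounded_linear_regularity[OF convex_Times[OF C(1) D(1)] z0 T, of R]
    unfolding T_def R_def by auto
  have "infdist (x, u) ((C \<times> D) \<inter> {z. T z = 0}) \<le> \<kappa> * (infdist x C + infdist u D + norm (A x - u))"
    (is "?i \<le> _") if "(x, u) \<in> B" for x u
  proof -
    \<comment> \<open>Solved for \<open>dist x c\<close>, so that the infimum over \<open>c\<close>
      and then that over \<open>d\<close> can be taken one after the other, without choosing nearest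
      points.\<close>
    have 1: "?i / \<kappa> - norm (A x - u) - dist u d \<le> dist x c" if "c \<in> C" "d \<in> D" for c d
    proof -
      have "?i \<le> \<kappa> * (dist (x, u) (c, d) + norm (A x - u))"
        using reg[OF RB[OF \<open>(x, u) \<in> B\<close>], of "(c, d)"] that by (simp add: T_def)
      then have "?i / \<kappa> \<le> dist (x, u) (c, d) + norm (A x - u)" using k by (simp add: field_simps)
      moreover have "dist (x, u) (c, d) \<le> dist x c + dist u d"
        unfolding dist_Pair_Pair by (rule sqrt_sum_squares_le_sum) auto
      ultimately show ?thesis by linarith
    qed
    have ne: "C \<noteq> {}" "D \<noteq> {}" using C D rel_interior_subset by blast+
    have "?i / \<kappa> - norm (A x - u) - dist u d \<le> infdist x C" if "d \<in> D" for d
      using 1[OF _ that] ne by (intro infdist_greatest) auto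
    then have "?i / \<kappa> - norm (A x - u) - infdist x C \<le> infdist u D"
      using ne by (intro infdist_greatest) (auto simp: algebra_simps)
    then have "?i / \<kappa> \<le> infdist x C + infdist u D + norm (A x - u)" by linarith
    then show ?thesis using k by (simp add: field_simps)
  qed
  then show ?thesis using k unfolding S by (intro exI[of _ \<kappa>]) auto
qed

section \<open>Primal solutions and growth of the augmented Lagrangian\<close>

text \<open>Here \<open>A'\<close> stands for minus the adjoint of \<open>A\<close>; with this sign the hypotheses are symmetric
  under exchanging the primal and the dual problem.\<close>

lemma primal_opt_eq:
  assumes fin: "\<bar>F x0\<bar> \<noteq> \<infinity>" "\<bar>G (A x0)\<bar> \<noteq> \<infinity>"
    and adj: "\<And>x y. y \<bullet> A x = - (A' y \<bullet> x)" and A: "linear A"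
    and sub: "A' y0 \<in> subdiff F x0" "y0 \<in> subdiff G (A x0)"
  shows "primal_opt F G A = {x. x \<in> subdiff_inv F (A' y0) \<and> A x \<in> subdiff_inv G y0}"
    and "x \<in> primal_opt F G A \<Longrightarrow> F x + G (A x) = F x0 + G (A x0)"
proof -
  interpret A: linear A by (rule A)
  obtain a b where ab: "F x0 = ereal a" "G (A x0) = ereal b" using fin by auto
  have sF: "F x \<ge> ereal (a + A' y0 \<bullet> (x - x0))" for x
    using sub(1) ab unfolding subdiff_def by auto
  have sG: "G u \<ge> ereal (b + y0 \<bullet> (u - A x0))" for u
    using sub(2) ab unfolding subdiff_def by auto
  have yA: "y0 \<bullet> (A x - A x0) = - (A' y0 \<bullet> (x - x0))" for x
    using adj[of y0 "x - x0"] by (simp add: A.diff)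
  \<comment> \<open>The slopes of the two affine minorants cancel along the graph of
    \<open>A\<close>, so \<open>x0\<close> is optimal with value \<open>a + b\<close>.\<close>
  have lb: "F x + G (A x) \<ge> ereal (a + b)" for x
    using add_mono[OF sF[of x] sG[of "A x"]] yA[of x] by simp
  have "(INF x. F x + G (A x)) = ereal (a + b)"
  proof (rule antisym)
    show "(INF x. F x + G (A x)) \<le> ereal (a + b)" by (rule INF_lower2[of x0]) (simp_all add: ab)
    show "ereal (a + b) \<le> (INF x. F x + G (A x))" using lb by (rule INF_greatest)
  qed
  then have opt: "x \<in> primal_opt F G A \<longleftrightarrow> F x + G (A x) = ereal (a + b)" for x
    unfolding primal_opt_def primal_obj_def by auto
  show "F x + G (A x) = F x0 + G (A x0)" if "x \<in> primal_opt F G A" using that opt ab by simp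
  \<comment> \<open>Membership means that \<open>F\<close> touches its affine minorant at
    \<open>x\<close>.\<close>
  have iF: "x \<in> subdiff_inv F (A' y0) \<longleftrightarrow> F x = ereal (a + A' y0 \<bullet> (x - x0))" for x
  proof
    assume "x \<in> subdiff_inv F (A' y0)"
    then have "F x0 \<ge> F x + ereal (A' y0 \<bullet> (x0 - x))" unfolding subdiff_inv_def subdiff_def by blast
    then show "F x = ereal (a + A' y0 \<bullet> (x - x0))"
      using sF[of x] ab by (cases "F x") (auto simp: inner_diff_right)
  next
    assume *: "F x = ereal (a + A' y0 \<bullet> (x - x0))"
    show "x \<in> subdiff_inv F (A' y0)" unfolding subdiff_inv_def subdiff_def
    proof (intro CollectI allI)
      fix y show "F x + ereal (A' y0 \<bullet> (y - x)) \<le> F y"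
        using sF[of y] * by (simp add: inner_diff_right)
    qed
  qed
  have iG: "u \<in> subdiff_inv G y0 \<longleftrightarrow> G u = ereal (b + y0 \<bullet> (u - A x0))" for u
  proof
    assume "u \<in> subdiff_inv G y0"
    then have "G (A x0) \<ge> G u + ereal (y0 \<bullet> (A x0 - u))" unfolding subdiff_inv_def subdiff_def by blast
    then show "G u = ereal (b + y0 \<bullet> (u - A x0))"
      using sG[of u] ab by (cases "G u") (auto simp: inner_diff_right)
  next
    assume *: "G u = ereal (b + y0 \<bullet> (u - A x0))"
    show "u \<in> subdiff_inv G y0" unfolding subdiff_inv_def subdiff_def
    proof (intro CollectI allI)
      fix y show "G u + ereal (y0 \<bullet> (y - u)) \<le> G y"
        using sG[of y] * by (simp add: inner_diff_right)
    qed
  qed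
  show "primal_opt F G A = {x. x \<in> subdiff_inv F (A' y0) \<and> A x \<in> subdiff_inv G y0}"
  proof (intro set_eqI)
    fix x
    \<comment> \<open>The value \<open>a + b\<close> is the sum of the two minorants at
      \<open>x\<close>, so it is attained exactly when both minorants are touched.\<close>
    show "x \<in> primal_opt F G A \<longleftrightarrow> x \<in> {x. x \<in> subdiff_inv F (A' y0) \<and> A x \<in> subdiff_inv G y0}"
      using sF[of x] sG[of "A x"] yA[of x] unfolding opt mem_Collect_eq iF iG
      by (cases "F x"; cases "G (A x)") auto
  qed
qed

text \<open>The growth of \<open>F\<close> and \<open>G\<close> holds with the slopes
  \<open>A' ys\<close> and \<open>ys\<close>, whose linear terms cancel against the multiplier term.
  What remains is the squared distances to the two inverse subdifferentials and the penalty, which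
  regularity compares with the distance to \<open>P_star\<close>. The multiplier enters only through
  subgradient conditions at \<open>x0\<close> and \<open>A x0\<close>, so that the lemma serves both
  problems.\<close>

lemma aug_lag_P_growth:
  fixes F :: "'a::euclidean_space \<Rightarrow> ereal" and G :: "'b::euclidean_space \<Rightarrow> ereal"
  assumes fin: "\<bar>F x0\<bar> \<noteq> \<infinity>" "\<bar>G (A x0)\<bar> \<noteq> \<infinity>"
    and adj: "\<And>x y. y \<bullet> A x = - (A' y \<bullet> x)" and A: "linear A" and A': "linear A'"
    and q: "QSV F x0 (A' y0)" "QSV G (A x0) y0"
    and ri: "A' y0 \<in> rel_interior (subdiff F x0)" "y0 \<in> rel_interior (subdiff G (A x0))"
    and cv: "convex (subdiff_inv F (A' y0))" "convex (subdiff_inv G y0)"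
    and ri': "x0 \<in> rel_interior (subdiff_inv F (A' y0))" "A x0 \<in> rel_interior (subdiff_inv G y0)"
    and \<beta>: "\<beta> > 0"
  shows "\<exists>r>0. \<forall>B. compact B \<longrightarrow> (\<exists>\<alpha>>0. \<forall>(x, u)\<in>B. \<forall>xs ys.
    xs \<in> primal_opt F G A \<longrightarrow> A' ys \<in> subdiff F x0 \<longrightarrow> ys \<in> subdiff G (A x0) \<longrightarrow> dist y0 ys \<le> r \<longrightarrow>
    aug_lag_P \<beta> F G A x u ys - aug_lag_P \<beta> F G A xs (A xs) ys
      \<ge> ereal (\<alpha> * (infdist (x, u) (P_star F G A))\<^sup>2))"
proof -
  interpret A: linear A by (rule A)
  interpret A': linear A' by (rule A')
  obtain a b where ab: "F x0 = ereal a" "G (A x0) = ereal b" using fin by auto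
  have sub: "A' y0 \<in> subdiff F x0" "y0 \<in> subdiff G (A x0)"
    using q unfolding QSV_def by auto
  note opt = primal_opt_eq[OF fin adj A sub]
  let ?C = "subdiff_inv F (A' y0)" and ?D = "subdiff_inv G y0"
  have P: "P_star F G A = {(x, A x) | x. x \<in> ?C \<and> A x \<in> ?D}"
    unfolding P_star_def opt(1) by simp
  obtain eF where eF: "eF > 0" and gF: "\<And>K. compact K \<Longrightarrow> \<exists>\<alpha>>0. \<forall>y\<in>K. \<forall>v\<in>subdiff F x0. dist (A' y0) v \<le> eF \<longrightarrow>
    F y \<ge> F x0 + ereal (v \<bullet> (y - x0)) + ereal (\<alpha> * (infdist y ?C)\<^sup>2)"
    using QSV_uniform[OF fin(1) q(1) ri(1)] by blast
  obtain eG where eG: "eG > 0" and gG: "\<And>K. compact K \<Longrightarrow> \<exists>\<alpha>>0. \<forall>y\<in>K. \<forall>v\<in>subdiff G (A x0). dist y0 v \<le> eG \<longrightarrow>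
    G y \<ge> G (A x0) + ereal (v \<bullet> (y - A x0)) + ereal (\<alpha> * (infdist y ?D)\<^sup>2)"
    using QSV_uniform[OF fin(2) q(2) ri(2)] by blast
  obtain c where c: "c > 0" "\<And>x. norm (A' x) \<le> c * norm x"
    using linear_bounded_pos[OF A'] by blast
  \<comment> \<open>Dividing by \<open>c\<close> keeps \<open>A' ys\<close> within \<open>eF\<close>
    of \<open>A' y0\<close>.\<close>
  define r where "r = min eG (eF / c)"
  have r: "r > 0" using eF eG c by (simp add: r_def)
  have "\<exists>\<alpha>>0. \<forall>(x, u)\<in>B. \<forall>xs ys.
    xs \<in> primal_opt F G A \<longrightarrow> A' ys \<in> subdiff F x0 \<longrightarrow> ys \<in> subdiff G (A x0) \<longrightarrow> dist y0 ys \<le> r \<longrightarrow>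
    aug_lag_P \<beta> F G A x u ys - aug_lag_P \<beta> F G A xs (A xs) ys
      \<ge> ereal (\<alpha> * (infdist (x, u) (P_star F G A))\<^sup>2)" if B: "compact B" for B
  proof -
    have cB: "compact (fst ` B)" "compact (snd ` B)"
      using B by (auto intro!: compact_continuous_image continuous_intros)
    obtain \<alpha>F where aF: "\<alpha>F > 0" "\<And>y v. y \<in> fst ` B \<Longrightarrow> v \<in> subdiff F x0 \<Longrightarrow> dist (A' y0) v \<le> eF \<Longrightarrow>
      F y \<ge> F x0 + ereal (v \<bullet> (y - x0)) + ereal (\<alpha>F * (infdist y ?C)\<^sup>2)"
      using gF[OF cB(1)] by blast
    obtain \<alpha>G where aG: "\<alpha>G > 0" "\<And>y v. y \<in> snd ` B \<Longrightarrow> v \<in> subdiff G (A x0) \<Longrightarrow> dist y0 v \<le> eG \<Longrightarrow>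
      G y \<ge> G (A x0) + ereal (v \<bullet> (y - A x0)) + ereal (\<alpha>G * (infdist y ?D)\<^sup>2)"
      using gG[OF cB(2)] by blast
    obtain \<kappa> where k: "\<kappa> > 0" "\<And>x u. (x, u) \<in> B \<Longrightarrow>
      infdist (x, u) (P_star F G A) \<le> \<kappa> * (infdist x ?C + infdist u ?D + norm (A x - u))"
      using graph_regularity[OF cv(1) ri'(1) cv(2) ri'(2) A compact_imp_bounded[OF B]]
      unfolding P by blast
    define m where "m = min (min \<alpha>F \<alpha>G) (1 / (2 * \<beta>))"
    have m: "m > 0" "m \<le> \<alpha>F" "m \<le> \<alpha>G" "m \<le> 1 / (2 * \<beta>)" using aF aG \<beta> by (auto simp: m_def)
    \<comment> \<open>The factor 3 comes from bounding the square of a sum of three terms,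
      \<open>\<kappa>\<^sup>2\<close> from squaring the regularity estimate.\<close>
    define \<alpha> where "\<alpha> = m / (3 * \<kappa>\<^sup>2)"
    have \<alpha>: "\<alpha> > 0" using m k by (simp add: \<alpha>_def)
    have "aug_lag_P \<beta> F G A x u ys - aug_lag_P \<beta> F G A xs (A xs) ys
      \<ge> ereal (\<alpha> * (infdist (x, u) (P_star F G A))\<^sup>2)"
      if xu: "(x, u) \<in> B" and xs: "xs \<in> primal_opt F G A" and ys: "A' ys \<in> subdiff F x0"
        "ys \<in> subdiff G (A x0)" "dist y0 ys \<le> r" for x u xs ys
    proof -
      let ?p = "infdist x ?C" and ?q = "infdist u ?D" and ?n = "norm (A x - u)"
      let ?i = "infdist (x, u) (P_star F G A)"
      have "dist (A' y0) (A' ys) \<le> c * dist y0 ys"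
        using c(2)[of "y0 - ys"] by (simp add: dist_norm A'.diff)
      also have "\<dots> \<le> c * (eF / c)" using ys(3) c(1) by (intro mult_left_mono) (auto simp: r_def)
      finally have dA: "dist (A' y0) (A' ys) \<le> eF" using c(1) by simp
      have xB: "x \<in> fst ` B" "u \<in> snd ` B" using xu by force+
      have dG: "dist y0 ys \<le> eG" using ys(3) by (simp add: r_def)
      have 1: "F x \<ge> ereal (a + A' ys \<bullet> (x - x0) + \<alpha>F * ?p\<^sup>2)"
        "G u \<ge> ereal (b + ys \<bullet> (u - A x0) + \<alpha>G * ?q\<^sup>2)"
        using aF(2)[OF xB(1) ys(1) dA] aG(2)[OF xB(2) ys(2) dG] unfolding ab plus_ereal.simps(1) .
      have "ereal ((a + A' ys \<bullet> (x - x0) + \<alpha>F * ?p\<^sup>2) + (b + ys \<bullet> (u - A x0) + \<alpha>G * ?q\<^sup>2)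
          + ys \<bullet> (A x - u) + 1 / (2 * \<beta>) * ?n\<^sup>2)
        \<le> aug_lag_P \<beta> F G A x u ys"
        using add_right_mono[OF add_right_mono[OF add_mono[OF 1], of "ereal (ys \<bullet> (A x - u))"],
          of "ereal (1 / (2 * \<beta>) * ?n\<^sup>2)"]
        unfolding aug_lag_P_def plus_ereal.simps(1) .
      moreover have "(a + A' ys \<bullet> (x - x0) + \<alpha>F * ?p\<^sup>2) + (b + ys \<bullet> (u - A x0) + \<alpha>G * ?q\<^sup>2)
          + ys \<bullet> (A x - u) + 1 / (2 * \<beta>) * ?n\<^sup>2
        = a + b + (\<alpha>F * ?p\<^sup>2 + \<alpha>G * ?q\<^sup>2 + 1 / (2 * \<beta>) * ?n\<^sup>2)"
        using adj[of ys x] adj[of ys x0] by (simp add: inner_diff_right)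
      ultimately have L: "ereal (a + b + (\<alpha>F * ?p\<^sup>2 + \<alpha>G * ?q\<^sup>2 + 1 / (2 * \<beta>) * ?n\<^sup>2))
          \<le> aug_lag_P \<beta> F G A x u ys"
        by (simp only:)
      \<comment> \<open>The residual vanishes here, so the optimal value remains for every
        multiplier.\<close>
      have Ls: "aug_lag_P \<beta> F G A xs (A xs) ys = ereal (a + b)"
        unfolding aug_lag_P_def using opt(2)[OF xs] ab by simp
      have "?i\<^sup>2 \<le> (\<kappa> * (?p + ?q + ?n))\<^sup>2"
        using k(2)[OF xu] by (intro power_mono) (auto simp: infdist_nonneg)
      also have "\<dots> = \<kappa>\<^sup>2 * (?p + ?q + ?n)\<^sup>2" by (simp add: power_mult_distrib)
      also have "\<dots> \<le> \<kappa>\<^sup>2 * (3 * (?p\<^sup>2 + ?q\<^sup>2 + ?n\<^sup>2))"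
      proof (rule mult_left_mono)
        \<comment> \<open>The right side equals three times the sum of the squares minus the square
          of the sum.\<close>
        have "0 \<le> (?p - ?q)\<^sup>2 + (?q - ?n)\<^sup>2 + (?p - ?n)\<^sup>2" by simp
        then show "(?p + ?q + ?n)\<^sup>2 \<le> 3 * (?p\<^sup>2 + ?q\<^sup>2 + ?n\<^sup>2)"
          by (simp add: power2_eq_square algebra_simps)
      qed simp
      finally have "\<alpha> * ?i\<^sup>2 \<le> \<alpha> * (\<kappa>\<^sup>2 * (3 * (?p\<^sup>2 + ?q\<^sup>2 + ?n\<^sup>2)))"
        using \<alpha> by (intro mult_left_mono) auto
      also have "\<dots> = m * ?p\<^sup>2 + m * ?q\<^sup>2 + m * ?n\<^sup>2"
        unfolding \<alpha>_def using k(1) by (simp add: field_simps)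
      also have "\<dots> \<le> \<alpha>F * ?p\<^sup>2 + \<alpha>G * ?q\<^sup>2 + 1 / (2 * \<beta>) * ?n\<^sup>2"
        using m by (intro add_mono mult_right_mono) auto
      finally have "ereal (a + b + \<alpha> * ?i\<^sup>2) \<le> aug_lag_P \<beta> F G A x u ys"
        using L by (meson add_left_mono ereal_less_eq(3) order_trans)
      then show ?thesis unfolding Ls
        by (cases "aug_lag_P \<beta> F G A x u ys") auto
    qed
    then show ?thesis using \<alpha> by (intro exI[of _ \<alpha>]) auto
  qed
  then show ?thesis using r by blast
qed

section \<open>The dual problem as a primal problem, and the theorem\<close>

text \<open>Negating the objective turns the supremum into an infimum. Properness keeps both
  conjugates away from minus infinity, so the negation distributes over the extended-real
  sum.\<close>

lemma dual_opt_eq_primal_opt: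
  assumes "proper_fun f" "proper_fun g"
  shows "dual_opt f g A = primal_opt (conjugate g) (conjugate f) (\<lambda>y. - adjoint A y)"
proof -
  have 1: "dual_obj f g A = (\<lambda>y. - primal_obj (conjugate g) (conjugate f) (\<lambda>y. - adjoint A y) y)"
  proof
    fix y
    show "dual_obj f g A y = - primal_obj (conjugate g) (conjugate f) (\<lambda>y. - adjoint A y) y"
      unfolding dual_obj_def primal_obj_def
      using conjugate_not_MInf[OF assms(1), of "- adjoint A y"] conjugate_not_MInf[OF assms(2), of y]
      by (cases "conjugate f (- adjoint A y)"; cases "conjugate g y") auto
  qed
  show ?thesis unfolding dual_opt_def primal_opt_def 1 ereal_SUP_uminus_eq
    by (simp add: ereal_uminus_eq_reorder)
qed

lemma aug_lag_D_eq_aug_lag_P: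
  "aug_lag_D \<beta> f g A y v x = aug_lag_P \<beta> (conjugate g) (conjugate f) (\<lambda>y. - adjoint A y) y v x"
proof -
  have "norm (adjoint A y + v) = norm (- adjoint A y - v)"
    by (metis minus_add_distrib norm_minus_cancel uminus_add_conv_diff add.commute)
  then show ?thesis unfolding aug_lag_D_def aug_lag_P_def by (simp add: add.commute)
qed

lemma D_star_eq_P_star:
  assumes "proper_fun f" "proper_fun g"
  shows "D_star f g A = P_star (conjugate g) (conjugate f) (\<lambda>y. - adjoint A y)"
  unfolding D_star_def P_star_def dual_opt_eq_primal_opt[OF assms] by simp

theorem mainTheorem6:
  fixes f :: "'e::euclidean_space \<Rightarrow> ereal"
    and g :: "'f::euclidean_space \<Rightarrow> ereal"
    and A :: "'e \<Rightarrow> 'f"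
    and x0 :: 'e and y0 :: 'f and \<beta> :: real
  assumes "proper_fun f" "closed_fun f" "convex_fun f"
    and "proper_fun g" "closed_fun g" "convex_fun g"
    and "linear A"
    and "(x0, y0) \<in> primal_dual_opt f g A"
    and "strict_compl f g A x0 y0"
    and "QSV f x0 (- adjoint A y0)"
    and "QSV g (A x0) y0"
    and "QSV (conjugate f) (- adjoint A y0) x0"
    and "QSV (conjugate g) y0 (A x0)"
    and "\<beta> > 0"
  shows "\<exists>r>0. \<forall>B :: ('e \<times> 'e \<times> 'f \<times> 'f) set. compact B \<longrightarrow>
    (\<exists>\<alpha>1>0. \<exists>\<alpha>2>0. \<forall>(x, v, y, u) \<in> B.
       \<forall>(xs, ys) \<in> primal_dual_opt f g A \<inter> cball (x0, y0) r.
         aug_lag_P \<beta> f g A x u ys - aug_lag_P \<beta> f g A xs (A xs) ys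
           \<ge> ereal (\<alpha>1 * (infdist (x, u) (P_star f g A))\<^sup>2) \<and>
         aug_lag_D \<beta> f g A y v xs - aug_lag_D \<beta> f g A ys (- adjoint A ys) xs
           \<ge> ereal (\<alpha>2 * (infdist (y, v) (D_star f g A))\<^sup>2))"
proof -
  let ?A' = "\<lambda>y. - adjoint A y" and ?f = "conjugate f" and ?g = "conjugate g"
  have A': "linear ?A'" using adjoint_linear[OF assms(7)] by (rule linear_compose_neg)
  have adj: "y \<bullet> A x = - (?A' y \<bullet> x)" for x y
    using adjoint_works[OF assms(7), of x y] by (simp add: inner_commute)
  \<comment> \<open>Taking minus the adjoint twice gives back \<open>A\<close>, so in the dual
    application \<open>A\<close> takes the place of \<open>A'\<close>.\<close>
  have adj': "x \<bullet> ?A' y = - (A x \<bullet> y)" for x y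
    using adj[of y x] by (simp add: inner_commute)
  have sub: "?A' y0 \<in> subdiff f x0" "y0 \<in> subdiff g (A x0)" "x0 \<in> subdiff ?f (?A' y0)" "A x0 \<in> subdiff ?g y0"
    using assms(10-13) unfolding QSV_def by auto
  have pf: "proper_fun ?f" and pg: "proper_fun ?g"
    using proper_fun_conjugate[OF assms(1) sub(1)] proper_fun_conjugate[OF assms(4) sub(2)] .
  note fin = subdiff_finite[OF assms(1) sub(1)] subdiff_finite[OF assms(4) sub(2)]
    subdiff_finite[OF pf sub(3)] subdiff_finite[OF pg sub(4)]
  note iff = subdiff_conjugate_iff[OF assms(1-3) pf] subdiff_conjugate_iff[OF assms(4-6) pg]
  \<comment> \<open>Turns the inverse subdifferentials of the growth conditions into the sets whose
    relative interiors occur in strict complementarity.\<close>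
  have inv: "subdiff_inv f v = subdiff ?f v" "subdiff_inv ?f x = subdiff f x"
    "subdiff_inv g y = subdiff ?g y" "subdiff_inv ?g u = subdiff g u" for v x y u
    unfolding subdiff_inv_def using iff by auto
  have cv: "convex (subdiff f x0)" "convex (subdiff g (A x0))"
    "convex (subdiff ?f (?A' y0))" "convex (subdiff ?g y0)"
    using fin by (simp_all add: convex_subdiff)
  have ri: "?A' y0 \<in> rel_interior (subdiff f x0)" "y0 \<in> rel_interior (subdiff g (A x0))"
    "x0 \<in> rel_interior (subdiff ?f (?A' y0))" "A x0 \<in> rel_interior (subdiff ?g y0)"
    using assms(9) unfolding strict_compl_def by auto
  have popt: "primal_opt f g A = {x. x \<in> subdiff ?f (?A' y0) \<and> A x \<in> subdiff ?g y0}"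
    using primal_opt_eq(1)[of f x0 g A ?A' y0, OF fin(1,2) adj assms(7) sub(1,2)] unfolding inv by simp
  \<comment> \<open>Dual solutions satisfy exactly the conditions that the primal growth lemma puts
    on the multiplier; \<open>popt\<close> does the same for the dual growth bound.\<close>
  have dopt: "dual_opt f g A = {y. y \<in> subdiff g (A x0) \<and> ?A' y \<in> subdiff f x0}"
    using primal_opt_eq(1)[of ?g y0 ?f ?A' A x0, OF fin(4,3) adj' A' sub(4,3)]
    unfolding inv dual_opt_eq_primal_opt[OF assms(1,4)] by simp
  obtain r1 where r1: "r1 > 0" and P: "\<And>B. compact B \<Longrightarrow> \<exists>\<alpha>>0. \<forall>(x, u)\<in>B. \<forall>xs ys.
    xs \<in> primal_opt f g A \<longrightarrow> ?A' ys \<in> subdiff f x0 \<longrightarrow> ys \<in> subdiff g (A x0) \<longrightarrow> dist y0 ys \<le> r1 \<longrightarrow>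
    aug_lag_P \<beta> f g A x u ys - aug_lag_P \<beta> f g A xs (A xs) ys
      \<ge> ereal (\<alpha> * (infdist (x, u) (P_star f g A))\<^sup>2)"
    using aug_lag_P_growth[of f x0 g A ?A' y0 \<beta>, OF fin(1,2) adj assms(7) A' assms(10,11) ri(1,2)]
    unfolding inv using cv(3,4) ri(3,4) assms(14) by blast
  \<comment> \<open>With the problems exchanged, \<open>ys\<close> is the solution and
    \<open>xs\<close> the multiplier that has to stay near \<open>x0\<close>.\<close>
  obtain r2 where r2: "r2 > 0" and D: "\<And>B. compact B \<Longrightarrow> \<exists>\<alpha>>0. \<forall>(y, v)\<in>B. \<forall>ys xs.
    ys \<in> dual_opt f g A \<longrightarrow> A xs \<in> subdiff ?g y0 \<longrightarrow> xs \<in> subdiff ?f (?A' y0) \<longrightarrow> dist x0 xs \<le> r2 \<longrightarrow>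
    aug_lag_D \<beta> f g A y v xs - aug_lag_D \<beta> f g A ys (- adjoint A ys) xs
      \<ge> ereal (\<alpha> * (infdist (y, v) (D_star f g A))\<^sup>2)"
    using aug_lag_P_growth[of ?g y0 ?f ?A' A x0 \<beta>, OF fin(4,3) adj' A' assms(7) assms(13,12) ri(4,3)]
    unfolding inv aug_lag_D_eq_aug_lag_P D_star_eq_P_star[OF assms(1,4)] dual_opt_eq_primal_opt[OF assms(1,4)]
    using cv(1,2) ri(1,2) assms(14) by blast
  show ?thesis
  proof (rule exI[of _ "min r1 r2"], intro conjI allI impI)
    fix B :: "('e \<times> 'e \<times> 'f \<times> 'f) set" assume B: "compact B"
    have "compact ((\<lambda>(x, v, y, u). (x, u)) ` B)" "compact ((\<lambda>(x, v, y, u). (y, v)) ` B)"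
      using B by (auto intro!: compact_continuous_image continuous_intros simp: case_prod_beta)
    from P[OF this(1)] D[OF this(2)] obtain \<alpha>1 \<alpha>2 where
      a1: "\<alpha>1 > 0" "\<And>x v y u xs ys. (x, v, y, u) \<in> B \<Longrightarrow> xs \<in> primal_opt f g A \<Longrightarrow> ?A' ys \<in> subdiff f x0 \<Longrightarrow>
        ys \<in> subdiff g (A x0) \<Longrightarrow> dist y0 ys \<le> r1 \<Longrightarrow>
        aug_lag_P \<beta> f g A x u ys - aug_lag_P \<beta> f g A xs (A xs) ys
          \<ge> ereal (\<alpha>1 * (infdist (x, u) (P_star f g A))\<^sup>2)" and
      a2: "\<alpha>2 > 0" "\<And>x v y u xs ys. (x, v, y, u) \<in> B \<Longrightarrow> ys \<in> dual_opt f g A \<Longrightarrow> A xs \<in> subdiff ?g y0 \<Longrightarrow>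
        xs \<in> subdiff ?f (?A' y0) \<Longrightarrow> dist x0 xs \<le> r2 \<Longrightarrow>
        aug_lag_D \<beta> f g A y v xs - aug_lag_D \<beta> f g A ys (- adjoint A ys) xs
          \<ge> ereal (\<alpha>2 * (infdist (y, v) (D_star f g A))\<^sup>2)"
      by fastforce
    have "aug_lag_P \<beta> f g A x u ys - aug_lag_P \<beta> f g A xs (A xs) ys
           \<ge> ereal (\<alpha>1 * (infdist (x, u) (P_star f g A))\<^sup>2) \<and>
         aug_lag_D \<beta> f g A y v xs - aug_lag_D \<beta> f g A ys (- adjoint A ys) xs
           \<ge> ereal (\<alpha>2 * (infdist (y, v) (D_star f g A))\<^sup>2)"
      if b: "(x, v, y, u) \<in> B" and s: "(xs, ys) \<in> primal_dual_opt f g A \<inter> cball (x0, y0) (min r1 r2)"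
      for x v y u xs ys
    proof -
      have o: "xs \<in> primal_opt f g A" "ys \<in> dual_opt f g A" using s unfolding primal_dual_opt_def by auto
      have "dist (x0, y0) (xs, ys) \<le> min r1 r2" using s by simp
      moreover have "dist x0 xs \<le> dist (x0, y0) (xs, ys)" "dist y0 ys \<le> dist (x0, y0) (xs, ys)"
        using dist_fst_le[of "(x0, y0)" "(xs, ys)"] dist_snd_le[of "(x0, y0)" "(xs, ys)"] by auto
      ultimately have d: "dist y0 ys \<le> r1" "dist x0 xs \<le> r2" by auto
      show ?thesis
        using a1(2)[OF b o(1) _ _ d(1)] a2(2)[OF b o(2) _ _ d(2)] o unfolding popt dopt by auto
    qed
    then show "\<exists>\<alpha>1>0. \<exists>\<alpha>2>0. \<forall>(x, v, y, u) \<in> B.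
       \<forall>(xs, ys) \<in> primal_dual_opt f g A \<inter> cball (x0, y0) (min r1 r2).
         aug_lag_P \<beta> f g A x u ys - aug_lag_P \<beta> f g A xs (A xs) ys
           \<ge> ereal (\<alpha>1 * (infdist (x, u) (P_star f g A))\<^sup>2) \<and>
         aug_lag_D \<beta> f g A y v xs - aug_lag_D \<beta> f g A ys (- adjoint A ys) xs
           \<ge> ereal (\<alpha>2 * (infdist (y, v) (D_star f g A))\<^sup>2)"
      using a1(1) a2(1) by blast
  qed (use r1 r2 in auto)
qed

end
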